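(* Let $\mathcal{H}$ be a Hilbert space with $N=\dim\mathcal{H}$, and let $\mathcal{Q}$ be the collection of complete sets of simultaneously observable one-dimensional projection operators on $\mathcal{H}$; that is, each $Q_i\in\mathcal{Q}$ is a set of $N$ commuting one-dimensional orthogonal projections with $\sum_{\hat P_j\in Q_i}\hat P_j=\hat 1$. Fix a quantum state, and let $p$ be the probability assignment on the elements of each $Q_i$ given by Born's rule for this state. Let $\{R^*_i\}$ be a collection of dichotomous (two-valued) extended random variables on a signed measure space $(\Omega,\mathcal{F},\mu)$ such that for each $Q_i\in\mathcal{Q}$ there is a $\mu$-induced context $C_i$ whose elements are in one-to-one correspondence $\hat P_j\leftrightarrow R^*_j$ with the elements of $Q_i$, with the same marginal probability distributions, i.e. within the context $C_i$ the expectations of $R^*_j$ and $\hat P_j$ are the same, as are all higher (joint) moments in combination with other variables in the same context. Then $(\Omega,\mathcal{F},\mu)$, endowed with the contexts $C_i$, is a signed (negative) probability space representing all contexts $C_i$; in particular $\mu(\Omega)=1$.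
   Context: Born's rule: for a quantum state with density operator $\rho$ on $\mathcal{H}$ the expectation of an observable $\hat O$ is $\langle\hat O\rangle=\operatorname{tr}(\rho\hat O)$; in particular a projection $\hat P$ has probability $\operatorname{tr}(\rho\hat P)$. Signed measure: for a set $\Omega$ and a $\sigma$-algebra $\mathcal{F}$ on $\Omega$, a signed measure is a function $\mu:\mathcal{F}\to\mathbb{R}$ with $\mu(\emptyset)=0$ and $\mu(\bigcup_i A_i)=\sum_i\mu(A_i)$ for every countable pairwise disjoint family $\{A_i\}_{i\in\mathbb{N}}\subseteq\mathcal{F}$. The triple $(\Omega,\mathcal{F},\mu)$ is called a signed measure space. Extended random variable: given a signed measure space $(\Omega,\mathcal{F},\mu)$ and a Borel space $(M,\mathcal{M})$ with $M\subseteq\mathbb{R}$, a (real-valued) extended random variable is a measurable function $R^*:\Omega\to M$, i.e. $(R^* )^{-1}(m)\in\mathcal{F}$ for all $m\in\mathcal{M}$. $\mu$-induced context: let $\{R^*_i\}_{i\in I}$ be a collection of extended random variables on a signed measure space $(\Omega,\mathcal{F},\mu)$. A $\mu$-induced context is a subset $C_j=\{R^*_k\}_{k\in N_j}$, $N_j\subset I$, for which there exists a sub-$\sigma$-algebra $\mathcal{F}_j$ of $\mathcal{F}$ such that, setting $p^\mu_j(F):=\mu(F)$ for all $F\in\mathcal{F}_j$, the triple $(\Omega,\mathcal{F}_j,p^\mu_j)$ is a probability space and, for every $k\in N_j$, $R^*_k$ is a random variable on it (i.e. is $\mathcal{F}_j$-measurable). Expectations and moments within the context are taken with respect to $p^\mu_j$.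 Signed (or negative) probability space: a signed measure space $(\Omega,\mathcal{F},\mu)$ endowed with a non-empty set of contexts (in the sense just defined) and such that $\mu(\Omega)=1$. *)

theory Defs
  imports "HOL-Probability.Probability"
begin

text \<open>The inner product is linear in its second argument.\<close>

class chilbert_space = banach +
  fixes cscale :: "complex \<Rightarrow> 'a \<Rightarrow> 'a"
    and cinner :: "'a \<Rightarrow> 'a \<Rightarrow> complex"
  assumes cscale_add_right: "cscale a (x + y) = cscale a x + cscale a y"
    and cscale_add_left: "cscale (a + b) x = cscale a x + cscale b x"
    and cscale_cscale: "cscale a (cscale b x) = cscale (a * b) x"
    and scaleR_cscale: "scaleR r x = cscale (complex_of_real r) x"
    and cinner_commute: "cinner x y = cnj (cinner y x)"
    and cinner_add_right: "cinner x (y + z) = cinner x y + cinner x z"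
    and cinner_cscale_right: "cinner x (cscale a y) = a * cinner x y"
    and cinner_self_nonneg: "0 \<le> Re (cinner x x)"
    and cinner_self_eq_0: "cinner x x = 0 \<longleftrightarrow> x = 0"
    and norm_eq_sqrt_cinner: "norm x = sqrt (Re (cinner x x))"

definition orthonormal_basis :: "'h::chilbert_space set \<Rightarrow> bool" where
  "orthonormal_basis B \<longleftrightarrow>
     (\<forall>b\<in>B. \<forall>c\<in>B. cinner b c = (if b = c then 1 else 0)) \<and>
     (\<forall>x. (\<forall>b\<in>B. cinner b x = 0) \<longrightarrow> x = 0)"

text \<open>Every Hilbert space has an orthonormal basis, and neither the cardinality of the basis
  nor the trace of a trace-class operator depends on its choice.\<close>

definition some_basis :: "'h::chilbert_space set" where
  "some_basis = (SOME B. orthonormal_basis B)"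

text \<open>The dimension is a cardinal, represented as in the library by a well-order. When it is
  finite, it is the usual dimension of the space.\<close>

definition hilbert_dim :: "'h::chilbert_space itself \<Rightarrow> 'h rel" where
  "hilbert_dim _ = card_of (some_basis :: 'h set)"

definition bounded_clinear :: "('h::chilbert_space \<Rightarrow> 'h) \<Rightarrow> bool" where
  "bounded_clinear A \<longleftrightarrow> bounded_linear A \<and> (\<forall>c x. A (cscale c x) = cscale c (A x))"

definition op_trace :: "('h::chilbert_space \<Rightarrow> 'h) \<Rightarrow> complex" where
  "op_trace A = (\<Sum>\<^sub>\<infinity>b\<in>some_basis. cinner b (A b))"

text \<open>A divergent infinite sum has value 0, so trace 1 forces a positive operator to be
  trace class.\<close>

definition density_operator :: "('h::chilbert_space \<Rightarrow> 'h) \<Rightarrow> bool" where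
  "density_operator \<rho> \<longleftrightarrow> bounded_clinear \<rho> \<and>
     (\<forall>x. cinner x (\<rho> x) \<in> \<real>\<^sub>\<ge>\<^sub>0) \<and> op_trace \<rho> = 1"

definition born :: "('h::chilbert_space \<Rightarrow> 'h) \<Rightarrow> ('h \<Rightarrow> 'h) \<Rightarrow> complex" where
  "born \<rho> A = op_trace (\<rho> \<circ> A)"

definition orthogonal_projection :: "('h::chilbert_space \<Rightarrow> 'h) \<Rightarrow> bool" where
  "orthogonal_projection P \<longleftrightarrow> bounded_clinear P \<and> P \<circ> P = P \<and>
     (\<forall>x y. cinner (P x) y = cinner x (P y))"

definition one_dim_projection :: "('h::chilbert_space \<Rightarrow> 'h) \<Rightarrow> bool" where
  "one_dim_projection P \<longleftrightarrow> orthogonal_projection P \<and>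
     (\<exists>v. v \<noteq> 0 \<and> range P = range (\<lambda>c. cscale c v))"

text \<open>The sum of the projections is taken in the strong operator topology; for a finite set
  it is the ordinary finite sum.\<close>

definition complete_projection_set :: "'h rel \<Rightarrow> ('h::chilbert_space \<Rightarrow> 'h) set \<Rightarrow> bool" where
  "complete_projection_set N Q \<longleftrightarrow>
     (card_of Q, N) \<in> ordIso \<and>
     (\<forall>P\<in>Q. one_dim_projection P) \<and>
     (\<forall>P\<in>Q. \<forall>P'\<in>Q. P \<circ> P' = P' \<circ> P) \<and>
     (\<forall>x. ((\<lambda>P. P x) has_sum x) Q)"

definition signed_measure_space :: "'a set \<Rightarrow> 'a set set \<Rightarrow> ('a set \<Rightarrow> real) \<Rightarrow> bool" where
  "signed_measure_space \<Omega> \<F> \<mu> \<longleftrightarrow> sigma_algebra \<Omega> \<F> \<and> \<mu> {} = 0 \<and>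
     (\<forall>A :: nat \<Rightarrow> 'a set. range A \<subseteq> \<F> \<and> disjoint_family A \<longrightarrow>
        (\<lambda>i. \<mu> (A i)) sums \<mu> (\<Union>i. A i))"

definition extended_random_variable ::
    "'a set \<Rightarrow> 'a set set \<Rightarrow> real set \<Rightarrow> ('a \<Rightarrow> real) \<Rightarrow> bool" where
  "extended_random_variable \<Omega> \<F> M X \<longleftrightarrow>
     X \<in> \<Omega> \<rightarrow> M \<and> (\<forall>m \<in> sets (restrict_space borel M). X -` m \<inter> \<Omega> \<in> \<F>)"

text \<open>A family of random variables is given by an index set \<open>I\<close> and a function \<open>R\<close>, a context
  by the set \<open>K\<close> of its indices. The probability space that \<open>\<mu>\<close> induces on a sub-sigma-algebra
  is the measure \<open>pr\<close>: the sub-sigma-algebra is \<open>sets pr\<close>, on which \<open>pr\<close> agrees with \<open>\<mu>\<close>.\<close>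

definition induced_probability ::
    "'a set \<Rightarrow> 'a set set \<Rightarrow> ('a set \<Rightarrow> real) \<Rightarrow> ('i \<Rightarrow> 'a \<Rightarrow> real) \<Rightarrow> 'i set \<Rightarrow> 'a measure \<Rightarrow> bool" where
  "induced_probability \<Omega> \<F> \<mu> R K pr \<longleftrightarrow>
     prob_space pr \<and> space pr = \<Omega> \<and> sets pr \<subseteq> \<F> \<and>
     (\<forall>A \<in> sets pr. measure pr A = \<mu> A) \<and>
     (\<forall>k\<in>K. R k \<in> borel_measurable pr)"

definition induced_context ::
    "'a set \<Rightarrow> 'a set set \<Rightarrow> ('a set \<Rightarrow> real) \<Rightarrow> 'i set \<Rightarrow> ('i \<Rightarrow> 'a \<Rightarrow> real) \<Rightarrow> 'i set \<Rightarrow> bool" where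
  "induced_context \<Omega> \<F> \<mu> I R K \<longleftrightarrow> K \<subseteq> I \<and> (\<exists>pr. induced_probability \<Omega> \<F> \<mu> R K pr)"

definition signed_probability_space ::
    "'a set \<Rightarrow> 'a set set \<Rightarrow> ('a set \<Rightarrow> real) \<Rightarrow> 'i set \<Rightarrow> ('i \<Rightarrow> 'a \<Rightarrow> real) \<Rightarrow> 'i set set \<Rightarrow> bool" where
  "signed_probability_space \<Omega> \<F> \<mu> I R \<C> \<longleftrightarrow>
     signed_measure_space \<Omega> \<F> \<mu> \<and>
     (\<forall>i\<in>I. \<exists>M. extended_random_variable \<Omega> \<F> M (R i)) \<and>
     \<C> \<noteq> {} \<and> (\<forall>K\<in>\<C>. induced_context \<Omega> \<F> \<mu> I R K) \<and>
     \<mu> \<Omega> = 1"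

text \<open>The context \<open>K\<close> represents the set \<open>Q\<close> of projections in the state \<open>\<rho>\<close>. The lists \<open>Ps\<close>
  may contain repetitions, so all mixed moments of all orders are covered.\<close>

definition represents_projections ::
    "('h::chilbert_space \<Rightarrow> 'h) \<Rightarrow> (('h \<Rightarrow> 'h) \<Rightarrow> real) \<Rightarrow>
     'a set \<Rightarrow> 'a set set \<Rightarrow> ('a set \<Rightarrow> real) \<Rightarrow> 'i set \<Rightarrow> ('i \<Rightarrow> 'a \<Rightarrow> real) \<Rightarrow>
     ('h \<Rightarrow> 'h) set \<Rightarrow> 'i set \<Rightarrow> bool" where
  "represents_projections \<rho> p \<Omega> \<F> \<mu> I R Q K \<longleftrightarrow>
     K \<subseteq> I \<and>
     (\<exists>pr j. induced_probability \<Omega> \<F> \<mu> R K pr \<and> bij_betw j Q K \<and>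
       (\<forall>P\<in>Q. (\<integral>\<omega>. R (j P) \<omega> \<partial>pr) = p P) \<and>
       (\<forall>Ps. Ps \<noteq> [] \<and> set Ps \<subseteq> Q \<longrightarrow>
          complex_of_real (\<integral>\<omega>. (\<Prod>P\<leftarrow>Ps. R (j P) \<omega>) \<partial>pr) = born \<rho> (foldr (\<circ>) Ps id)))"

end

theory Submission
  imports Defs
begin

text \<open>Each context carries a probability measure that agrees with \<open>\<mu>\<close> on its sigma-algebra, and
  this algebra contains \<open>\<Omega>\<close>; hence a single context already forces \<open>\<mu> \<Omega> = 1\<close>. What needs an
  argument is that there is a context at all, i.e. that the Hilbert space has a complete set of
  one-dimensional projections. An orthonormal basis exists by Zorn's lemma, and the Fourier
  expansion says that the projections onto its members sum strongly to the identity.\<close>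

section \<open>Inner products\<close>

lemma cinner_add_left: "cinner (x + y) z = cinner x z + cinner y (z::'h::chilbert_space)"
  by (metis cinner_add_right cinner_commute complex_cnj_add)

lemma cinner_cscale_left: "cinner (cscale a x) y = cnj a * cinner x (y::'h::chilbert_space)"
  by (metis cinner_cscale_right cinner_commute complex_cnj_mult)

lemma cinner_scaleR_right: "cinner x (r *\<^sub>R y) = r *\<^sub>R cinner x (y::'h::chilbert_space)"
  by (simp add: scaleR_cscale cinner_cscale_right scaleR_conv_of_real)

lemma cinner_scaleR_left: "cinner (r *\<^sub>R x) y = r *\<^sub>R cinner x (y::'h::chilbert_space)"
  by (simp add: scaleR_cscale cinner_cscale_left scaleR_conv_of_real)

lemma cinner_zero_right [simp]: "cinner x (0::'h::chilbert_space) = 0"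
  using cinner_scaleR_right[of x 0 0] by simp

lemma cinner_zero_left [simp]: "cinner (0::'h::chilbert_space) x = 0"
  using cinner_scaleR_left[of 0 0 x] by simp

lemma cinner_diff_right: "cinner x (y - z) = cinner x y - cinner x (z::'h::chilbert_space)"
  using cinner_add_right[of x "y - z" z] by simp

lemma cinner_diff_left: "cinner (x - y) z = cinner x z - cinner y (z::'h::chilbert_space)"
  using cinner_add_left[of "x - y" y z] by simp

lemma cinner_sum_right: "cinner x (sum f F) = (\<Sum>i\<in>F. cinner x (f i :: 'h::chilbert_space))"
  by (induction F rule: infinite_finite_induct) (simp_all add: cinner_add_right)

lemma cinner_sum_left: "cinner (sum f F) x = (\<Sum>i\<in>F. cinner (f i) (x :: 'h::chilbert_space))"
  by (induction F rule: infinite_finite_induct) (simp_all add: cinner_add_left)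

lemma power2_norm_eq_cinner: "(norm x)\<^sup>2 = Re (cinner x (x::'h::chilbert_space))"
  by (simp add: norm_eq_sqrt_cinner cinner_self_nonneg)

text \<open>Conjugate symmetry forces the imaginary part to vanish. Squared norms can thus be
  computed as complex inner products and compared at the end by
  \<open>of_real_eq_iff\<close>.\<close>

lemma cinner_self: "cinner x x = complex_of_real ((norm (x::'h::chilbert_space))\<^sup>2)"
proof -
  have "Im (cinner x x) = - Im (cinner x x)"
    by (metis cinner_commute cnj.sel(2))
  then show ?thesis
    by (simp add: complex_eq_iff power2_norm_eq_cinner)
qed

lemma norm_cscale: "norm (cscale c x) = cmod c * norm (x::'h::chilbert_space)"
proof -
  have "complex_of_real ((norm (cscale c x))\<^sup>2) = (c * cnj c) * complex_of_real ((norm x)\<^sup>2)"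
    unfolding cinner_self[symmetric] cinner_cscale_left cinner_cscale_right by simp
  also have "\<dots> = complex_of_real ((cmod c * norm x)\<^sup>2)"
    unfolding complex_norm_square[symmetric] by (simp add: power_mult_distrib)
  finally have "(norm (cscale c x))\<^sup>2 = (cmod c * norm x)\<^sup>2"
    by (simp only: of_real_eq_iff)
  then show ?thesis
    by (simp add: power2_eq_iff_nonneg)
qed

lemma cscale_one [simp]: "cscale 1 (x::'h::chilbert_space) = x"
  using scaleR_cscale[of 1 x] by simp

lemma cscale_zero_left [simp]: "cscale 0 (x::'h::chilbert_space) = 0"
  using scaleR_cscale[of 0 x] by simp

section \<open>Orthonormal sets\<close>

text \<open>The first half of \<open>orthonormal_basis\<close>, split off because Zorn's lemma runs
  over the sets with this property alone; maximality then yields the other half.\<close>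

definition orthonormal :: "'h::chilbert_space set \<Rightarrow> bool" where
  "orthonormal B \<longleftrightarrow> (\<forall>b\<in>B. \<forall>c\<in>B. cinner b c = (if b = c then 1 else 0))"

lemma orthonormal_basis_iff:
  "orthonormal_basis B \<longleftrightarrow> orthonormal B \<and> (\<forall>x. (\<forall>b\<in>B. cinner b x = 0) \<longrightarrow> x = 0)"
  by (simp add: orthonormal_basis_def orthonormal_def)

lemma orthonormalD:
  "orthonormal B \<Longrightarrow> b \<in> B \<Longrightarrow> c \<in> B \<Longrightarrow> cinner b c = (if b = c then 1 else 0)"
  by (simp add: orthonormal_def)

lemma orthonormal_singleton: "norm b = 1 \<Longrightarrow> orthonormal {b}"
  by (simp add: orthonormal_def cinner_self)

lemma orthonormal_norm: "orthonormal B \<Longrightarrow> b \<in> B \<Longrightarrow> norm b = 1"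
  by (simp add: orthonormal_def norm_eq_sqrt_cinner)

text \<open>A maximal orthonormal set is complete: a nonzero vector orthogonal to all of it could be
  normalized and adjoined.\<close>

lemma orthonormal_basis_exists: "\<exists>B::'h::chilbert_space set. orthonormal_basis B"
proof -
  have "\<exists>M\<in>Collect orthonormal. \<forall>X\<in>Collect orthonormal. (M::'h set) \<subseteq> X \<longrightarrow> X = M"
  proof (rule subset_Zorn')
    fix \<C> :: "'h set set"
    assume chain: "subset.chain (Collect orthonormal) \<C>"
    have "cinner b c = (if b = c then 1 else 0)" if bc: "b \<in> \<Union>\<C>" "c \<in> \<Union>\<C>" for b c
    proof -
      \<comment> \<open>Of two members of a chain one contains the other, so \<open>b\<close> and
        \<open>c\<close> lie in a common orthonormal set.\<close>
      obtain X Y where XY: "X \<in> \<C>" "b \<in> X" "Y \<in> \<C>" "c \<in> Y"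
        using bc by blast
      then have "X \<subseteq> Y \<or> Y \<subseteq> X" "orthonormal X" "orthonormal Y"
        using chain by (auto simp: subset_chain_def)
      with XY show ?thesis
        using orthonormalD[of X b c] orthonormalD[of Y b c] by blast
    qed
    then show "\<Union>\<C> \<in> Collect orthonormal"
      by (simp add: orthonormal_def)
  qed
  then obtain M :: "'h set" where M: "orthonormal M"
    and max: "\<And>X. orthonormal X \<Longrightarrow> M \<subseteq> X \<Longrightarrow> X = M"
    by blast
  have "x = 0" if x: "\<forall>b\<in>M. cinner b x = 0" for x
  proof (rule ccontr)
    assume "x \<noteq> 0"
    define u where "u = x /\<^sub>R norm x"
    have u: "cinner u u = 1"
      using \<open>x \<noteq> 0\<close> by (simp add: cinner_self u_def)
    have right: "cinner b u = 0" if "b \<in> M" for b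
      using x that by (simp add: u_def cinner_scaleR_right)
    moreover have "cinner u b = 0" if "b \<in> M" for b
      using right[OF that] cinner_commute[of u b] by simp
    ultimately have "orthonormal (insert u M)"
      using M u by (auto simp: orthonormal_def)
    \<comment> \<open>By maximality \<open>u\<close> already lies in \<open>M\<close>, hence is
      orthogonal to itself, although \<open>cinner u u = 1\<close>.\<close>
    then have "u \<in> M"
      using max by blast
    with right u show False
      by force
  qed
  with M show ?thesis
    unfolding orthonormal_basis_iff by blast
qed

lemma orthonormal_basis_some_basis: "orthonormal_basis (some_basis :: 'h::chilbert_space set)"
  unfolding some_basis_def using orthonormal_basis_exists by (rule someI_ex)

section \<open>Finite orthonormal sums, Bessel's inequality and the Fourier expansion\<close>

lemma cinner_sum_orthonormal:
  fixes B :: "'h::chilbert_space set"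
  assumes "orthonormal B" "finite F" "F \<subseteq> B" "b \<in> F"
  shows "cinner b (\<Sum>c\<in>F. cscale (f c) c) = f b"
proof -
  have "cinner b (\<Sum>c\<in>F. cscale (f c) c) = (\<Sum>c\<in>F. if b = c then f c else 0)"
    unfolding cinner_sum_right using assms
    by (intro sum.cong) (auto simp: cinner_cscale_right orthonormalD[OF assms(1)] subset_iff)
  then show ?thesis
    using assms by simp
qed

text \<open>Pythagoras: in the expanded square all cross terms vanish.\<close>

lemma norm_sum_orthonormal:
  fixes B :: "'h::chilbert_space set"
  assumes "orthonormal B" "finite F" "F \<subseteq> B"
  shows "(norm (\<Sum>b\<in>F. cscale (f b) b))\<^sup>2 = (\<Sum>b\<in>F. (cmod (f b))\<^sup>2)"
proof -
  have "complex_of_real ((norm (\<Sum>b\<in>F. cscale (f b) b))\<^sup>2) = (\<Sum>b\<in>F. cnj (f b) * f b)"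
    unfolding cinner_self[symmetric] cinner_sum_left
    by (intro sum.cong) (simp_all add: cinner_cscale_left cinner_sum_orthonormal[OF assms])
  also have "\<dots> = complex_of_real (\<Sum>b\<in>F. (cmod (f b))\<^sup>2)"
    by (simp only: of_real_sum complex_norm_square mult.commute)
  finally show ?thesis
    by (simp only: of_real_eq_iff)
qed

text \<open>With \<open>s\<close> the projection of \<open>x\<close> to the span of
  \<open>F\<close>, the numbers \<open>cinner s x\<close>, \<open>cinner x s\<close> and the squared
  norm of \<open>s\<close> all equal \<open>S\<close>. Hence the squared norm of
  \<open>x - s\<close> is that of \<open>x\<close> minus \<open>S\<close>, and it is
  nonnegative.\<close>

lemma bessel_inequality:
  fixes B :: "'h::chilbert_space set"
  assumes "orthonormal B" "finite F" "F \<subseteq> B"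
  shows "(\<Sum>b\<in>F. (cmod (cinner b x))\<^sup>2) \<le> (norm x)\<^sup>2"
proof -
  define s where "s = (\<Sum>b\<in>F. cscale (cinner b x) b)"
  define S where "S = (\<Sum>b\<in>F. (cmod (cinner b x))\<^sup>2)"
  have "cinner s x = (\<Sum>b\<in>F. cnj (cinner b x) * cinner b x)"
    by (simp add: s_def cinner_sum_left cinner_cscale_left)
  also have "\<dots> = complex_of_real S"
    unfolding S_def by (simp only: of_real_sum complex_norm_square mult.commute)
  finally have sx: "cinner s x = complex_of_real S" .
  then have xs: "cinner x s = complex_of_real S"
    by (metis cinner_commute complex_cnj_complex_of_real)
  have "(norm s)\<^sup>2 = S"
    unfolding s_def S_def by (rule norm_sum_orthonormal[OF assms])
  then have "(norm (x - s))\<^sup>2 = (norm x)\<^sup>2 - S"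
    by (simp add: power2_norm_eq_cinner cinner_diff_left cinner_diff_right sx xs)
  then show ?thesis
    by (metis S_def diff_ge_0_iff_ge zero_le_power2)
qed

text \<open>Cauchy-Schwarz for a unit vector is Bessel's inequality for a single vector.\<close>

lemma norm_cinner_unit_le:
  assumes "norm b = 1"
  shows "cmod (cinner b x) \<le> norm (x::'h::chilbert_space)"
  using bessel_inequality[OF orthonormal_singleton[OF assms], of "{b}" x] by simp

lemma bounded_linear_cinner_unit:
  assumes "norm (b::'h::chilbert_space) = 1"
  shows "bounded_linear (cinner b)"
  by (rule bounded_linear_intro[where K = 1])
    (simp_all add: cinner_add_right cinner_scaleR_right norm_cinner_unit_le[OF assms])

text \<open>Cauchy criterion for the net of finite partial sums. It is meant for orthogonal terms
  \<open>f\<close> with squared norms \<open>a\<close>: only the squares are controlled, so absolute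
  convergence cannot be used.\<close>

lemma summable_on_square_bound:
  fixes f :: "'b \<Rightarrow> 'c::banach" and a :: "'b \<Rightarrow> real"
  assumes bdd: "bdd_above (sum a ` {F. F \<subseteq> A \<and> finite F})"
    and bound: "\<And>F. finite F \<Longrightarrow> F \<subseteq> A \<Longrightarrow> (norm (sum f F))\<^sup>2 \<le> sum a F"
  shows "f summable_on A"
proof -
  let ?S = "sum a ` {F. F \<subseteq> A \<and> finite F}"
  have "\<exists>P. eventually P (finite_subsets_at_top A) \<and>
          (\<forall>F F'. P F \<and> P F' \<longrightarrow> dist (sum f F) (sum f F') < e)" if "e > 0" for e
  proof -
    \<comment> \<open>If \<open>F0\<close> comes within \<open>(e/2)\<^sup>2\<close> of the
      supremum, then \<open>a\<close> sums to less than that over any finite set of further indices,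
      and \<open>bound\<close> makes the sum of \<open>f\<close> there smaller than
      \<open>e/2\<close> in norm.\<close>
    have "Sup ?S - (e/2)\<^sup>2 < Sup ?S"
      using \<open>e > 0\<close> by simp
    then obtain F0 where F0: "F0 \<subseteq> A" "finite F0" "Sup ?S - (e/2)\<^sup>2 < sum a F0"
      by (subst (asm) less_cSup_iff) (use bdd in auto)
    define P where "P F \<longleftrightarrow> finite F \<and> F0 \<subseteq> F \<and> F \<subseteq> A" for F
    have close: "dist (sum f F) (sum f F0) < e/2" if "P F" for F
    proof -
      have F: "finite F" "F0 \<subseteq> F" "F \<subseteq> A"
        using that by (auto simp: P_def)
      have "(norm (sum f F - sum f F0))\<^sup>2 = (norm (sum f (F - F0)))\<^sup>2"
        using F by (simp add: sum_diff)
      also have "\<dots> \<le> sum a (F - F0)"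
        using F by (intro bound) auto
      also have "\<dots> = sum a F - sum a F0"
        using F by (simp add: sum_diff)
      also have "sum a F \<le> Sup ?S"
        using F by (intro cSup_upper bdd) auto
      finally have "(norm (sum f F - sum f F0))\<^sup>2 < (e/2)\<^sup>2"
        using F0(3) by linarith
      then show ?thesis
        unfolding dist_norm by (rule power2_less_imp_less) (use \<open>e > 0\<close> in simp)
    qed
    have "dist (sum f F) (sum f F') < e" if "P F" "P F'" for F F'
      using close[OF that(1)] close[OF that(2)] dist_triangle_half_l by blast
    moreover have "eventually P (finite_subsets_at_top A)"
      unfolding eventually_finite_subsets_at_top P_def using F0 by blast
    ultimately show ?thesis
      by blast
  qed
  then have "cauchy_filter (filtermap (sum f) (finite_subsets_at_top A))"
    by (simp add: cauchy_filter_metric_filtermap)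
  \<comment> \<open>Completeness of the space turns the Cauchy property into a limit.\<close>
  then have "convergent_filter (filtermap (sum f) (finite_subsets_at_top A))"
    by (rule cauchy_filter_convergent)
  then show ?thesis
    by (auto simp: convergent_filter_iff summable_on_def has_sum_def filterlim_def)
qed

text \<open>Bessel and Pythagoras make the series converge to some \<open>s\<close>. The difference
  \<open>x - s\<close> is orthogonal to every basis vector, so it is 0 by completeness of the
  basis.\<close>

lemma fourier_expansion:
  fixes B :: "'h::chilbert_space set"
  assumes B: "orthonormal_basis B"
  shows "((\<lambda>b. cscale (cinner b x) b) has_sum x) B"
proof -
  have on: "orthonormal B" and complete: "\<And>y. (\<And>b. b \<in> B \<Longrightarrow> cinner b y = 0) \<Longrightarrow> y = 0"
    using B unfolding orthonormal_basis_iff by blast+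
  have "(\<lambda>b. cscale (cinner b x) b) summable_on B"
  proof (rule summable_on_square_bound)
    show "bdd_above (sum (\<lambda>b. (cmod (cinner b x))\<^sup>2) ` {F. F \<subseteq> B \<and> finite F})"
      by (rule bdd_aboveI[where M = "(norm x)\<^sup>2"]) (auto intro: bessel_inequality[OF on])
  qed (simp_all add: norm_sum_orthonormal[OF on])
  then obtain s where s: "((\<lambda>b. cscale (cinner b x) b) has_sum s) B"
    by (auto simp: summable_on_def)
  have "x - s = 0"
  proof (rule complete)
    fix b assume b: "b \<in> B"
    \<comment> \<open>Continuity of \<open>cinner b\<close> lets it pass through the infinite sum;
      below, the same series is evaluated by its only nonzero term, \<open>c = b\<close>.\<close>
    have "((\<lambda>c. cinner b (cscale (cinner c x) c)) has_sum cinner b s) B"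
      by (intro has_sum_bounded_linear[OF _ s] bounded_linear_cinner_unit orthonormal_norm[OF on b])
    moreover have "((\<lambda>c. cinner b (cscale (cinner c x) c)) has_sum cinner b x) B"
      by (rule has_sum_finite_neutralI[where B = "{b}"])
        (auto simp: b cinner_cscale_right orthonormalD[OF on])
    ultimately have "cinner b s = cinner b x"
      by (rule has_sum_unique)
    then show "cinner b (x - s) = 0"
      by (simp add: cinner_diff_right)
  qed
  with s show ?thesis
    by simp
qed

section \<open>Rank-one projections\<close>

text \<open>For a unit vector \<open>b\<close> this is the orthogonal projection onto its line, the
  ket-bra of \<open>b\<close> with itself.\<close>

definition rank_one :: "'h::chilbert_space \<Rightarrow> 'h \<Rightarrow> 'h" where
  "rank_one b x = cscale (cinner b x) b"

lemma one_dim_projection_rank_one: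
  fixes b :: "'h::chilbert_space"
  assumes "norm b = 1"
  shows "one_dim_projection (rank_one b)"
proof -
  have bb: "cinner b b = 1"
    using assms by (simp add: cinner_self)
  have "bounded_linear (rank_one b)"
  proof (rule bounded_linear_intro[where K = 1])
    show "rank_one b (r *\<^sub>R x) = r *\<^sub>R rank_one b x" for r x
      unfolding rank_one_def scaleR_cscale cinner_cscale_right cscale_cscale ..
  qed (simp_all add: rank_one_def cinner_add_right cscale_add_left norm_cscale assms
      norm_cinner_unit_le)
  then have "bounded_clinear (rank_one b)"
    by (simp add: bounded_clinear_def rank_one_def cinner_cscale_right cscale_cscale)
  moreover have "rank_one b \<circ> rank_one b = rank_one b"
    by (simp add: fun_eq_iff rank_one_def cinner_cscale_right bb)
  moreover have "cinner (rank_one b x) y = cinner x (rank_one b y)" for x y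
    unfolding rank_one_def cinner_cscale_left cinner_cscale_right
    by (metis cinner_commute mult.commute)
  ultimately have "orthogonal_projection (rank_one b)"
    by (simp add: orthogonal_projection_def)
  moreover have "range (rank_one b) = range (\<lambda>c. cscale c b)"
  proof (intro equalityI subsetI)
    fix y assume "y \<in> range (\<lambda>c. cscale c b)"
    then obtain c where "y = cscale c b"
      by blast
    then have "y = rank_one b (cscale c b)"
      by (simp add: rank_one_def cinner_cscale_right bb)
    then show "y \<in> range (rank_one b)"
      by blast
  qed (auto simp: rank_one_def)
  moreover have "b \<noteq> 0"
    using assms by auto
  ultimately show ?thesis
    by (auto simp: one_dim_projection_def)
qed

text \<open>The result is symmetric in \<open>b\<close> and \<open>c\<close>, which is how
  commutativity is obtained.\<close>

lemma rank_one_comp: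
  fixes B :: "'h::chilbert_space set"
  assumes "orthonormal B" "b \<in> B" "c \<in> B"
  shows "rank_one b \<circ> rank_one c = (if b = c then rank_one b else (\<lambda>_. 0))"
  by (auto simp: fun_eq_iff rank_one_def cinner_cscale_right orthonormalD[OF assms(1)] assms)

text \<open>Applying equal projections to \<open>b\<close> gives
  \<open>b = cscale (cinner c b) c\<close>, which would be 0 for \<open>b \<noteq> c\<close>.
  Injectivity transfers both the cardinality and the infinite sum from the basis to its
  projections.\<close>

lemma inj_on_rank_one:
  fixes B :: "'h::chilbert_space set"
  assumes "orthonormal B"
  shows "inj_on rank_one B"
proof (rule inj_onI)
  fix b c assume bc: "b \<in> B" "c \<in> B" and "rank_one b = rank_one c"
  then have "cscale (cinner b b) b = cscale (cinner c b) c"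
    by (metis rank_one_def)
  then have b: "b = cscale (cinner c b) c"
    using bc by (simp add: orthonormalD[OF assms])
  show "b = c"
  proof (rule ccontr)
    assume "b \<noteq> c"
    then have "cinner c b = 0"
      using bc by (simp add: orthonormalD[OF assms])
    then have "b = 0"
      using b by (metis cscale_zero_left)
    then show False
      using orthonormal_norm[OF assms bc(1)] by simp
  qed
qed

text \<open>This witness shows that the collection of complete sets is nonempty.\<close>

lemma complete_projection_set_rank_one:
  "complete_projection_set (hilbert_dim TYPE('h::chilbert_space)) (rank_one ` (some_basis :: 'h set))"
proof -
  let ?B = "some_basis :: 'h set"
  have on: "orthonormal ?B"
    using orthonormal_basis_some_basis unfolding orthonormal_basis_iff by (rule conjunct1)
  have bij: "bij_betw rank_one ?B (rank_one ` ?B)"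
    by (simp add: bij_betw_def inj_on_rank_one[OF on])
  then have "(card_of (rank_one ` ?B), hilbert_dim TYPE('h)) \<in> ordIso"
    unfolding hilbert_dim_def by (rule card_of_ordIsoI[OF bij_betw_inv_into])
  \<comment> \<open>Reindexed along the bijection, the sum of projections applied to
    \<open>x\<close> is the Fourier series of \<open>x\<close>.\<close>
  moreover have "((\<lambda>P. P x) has_sum x) (rank_one ` ?B)" for x
    unfolding has_sum_reindex_bij_betw[OF bij, symmetric] rank_one_def
    by (rule fourier_expansion[OF orthonormal_basis_some_basis])
  moreover have "P \<circ> P' = P' \<circ> P" if "P \<in> rank_one ` ?B" "P' \<in> rank_one ` ?B" for P P'
    using that by (auto simp: rank_one_comp[OF on])
  moreover have "one_dim_projection P" if "P \<in> rank_one ` ?B" for P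
    using that by (auto intro!: one_dim_projection_rank_one orthonormal_norm[OF on])
  ultimately show ?thesis
    unfolding complete_projection_set_def by (intro conjI ballI allI)
qed

section \<open>Contexts\<close>

lemma represents_projections_induced_context:
  "represents_projections \<rho> p \<Omega> \<F> \<mu> I R Q K \<Longrightarrow> induced_context \<Omega> \<F> \<mu> I R K"
  by (auto simp: represents_projections_def induced_context_def)

lemma induced_context_total_mass:
  assumes "induced_context \<Omega> \<F> \<mu> I R K"
  shows "\<mu> \<Omega> = 1"
proof -
  obtain pr where "prob_space pr" "space pr = \<Omega>" "\<And>A. A \<in> sets pr \<Longrightarrow> measure pr A = \<mu> A"
    using assms by (auto simp: induced_context_def induced_probability_def)
  then show ?thesis
    \<comment> \<open>\<open>\<Omega>\<close> is the whole space of \<open>pr\<close>, so it belongs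
      to \<open>sets pr\<close>, where \<open>pr\<close> and \<mu> agree.\<close>
    by (metis prob_space.prob_space sets.top)
qed

theorem proposition5:
  fixes N :: "'h::chilbert_space rel"
    and \<Q> :: "('h \<Rightarrow> 'h) set set"
    and \<rho> :: "'h \<Rightarrow> 'h"
    and p :: "('h \<Rightarrow> 'h) \<Rightarrow> real"
    and \<Omega> :: "'a set" and \<F> :: "'a set set" and \<mu> :: "'a set \<Rightarrow> real"
    and I :: "'i set" and R :: "'i \<Rightarrow> 'a \<Rightarrow> real"
    and C :: "('h \<Rightarrow> 'h) set \<Rightarrow> 'i set"
  assumes "N = hilbert_dim TYPE('h)"
    and "\<Q> = {Q. complete_projection_set N Q}"
    and "density_operator \<rho>"
    and "\<forall>Q\<in>\<Q>. \<forall>P\<in>Q. p P = Re (born \<rho> P)"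
    and "signed_measure_space \<Omega> \<F> \<mu>"
    and "\<forall>i\<in>I. \<exists>M. card M = 2 \<and> extended_random_variable \<Omega> \<F> M (R i)"
    and "\<forall>Q\<in>\<Q>. represents_projections \<rho> p \<Omega> \<F> \<mu> I R Q (C Q)"
  shows "signed_probability_space \<Omega> \<F> \<mu> I R (C ` \<Q>) \<and>
    (\<forall>Q\<in>\<Q>. represents_projections \<rho> p \<Omega> \<F> \<mu> I R Q (C Q)) \<and>
    \<mu> \<Omega> = 1"
proof -
  \<comment> \<open>Without a member of \<open>\<Q>\<close> the hypothesis on contexts would be
    vacuous and \<mu> would not be normalized by it.\<close>
  have nonempty: "\<Q> \<noteq> {}"
    using assms(1,2) complete_projection_set_rank_one by blast
  have contexts: "\<forall>K \<in> C ` \<Q>. induced_context \<Omega> \<F> \<mu> I R K"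
    using assms(7) represents_projections_induced_context by blast
  with nonempty have "\<mu> \<Omega> = 1"
    using induced_context_total_mass by blast
  moreover from this nonempty contexts
  have "signed_probability_space \<Omega> \<F> \<mu> I R (C ` \<Q>)"
    \<comment> \<open>The two-point value sets serve as the witnesses \<open>M\<close>.\<close>
    using assms(5,6) by (auto simp: signed_probability_space_def)
  ultimately show ?thesis
    using assms(7) by blast
qed

end
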